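(* Assume the following conditions (stated in full in the context): (E1), (E2), (M1), (M2), (M3) and (M4). Suppose that $P_0$ belongs to $\mathcal{M}$ or that $P_0$ belongs to $\mathcal{M}_{\mathcal{E}}$, with corresponding parameter $\theta_0$ (so that $P_0=P_{\theta_0}\in\mathcal{M}_{\theta_0}$). Then, in probability as $n\to\infty$, $$D_\alpha(\mathcal{M},P_n)\to0,\qquad \widehat\theta_n\to\theta_0,\qquad d\big(q_{\widehat\theta_n},p_{\theta_0}\big)\to0,$$ where $\widehat\theta_n=\arg\inf_{\theta\in\Theta}\inf_{Q\in\mathcal{M}_{\theta,\mathcal{E}}}R_\alpha(Q,P_n)$, $q_{\widehat\theta_n}$ is the density of the minimizer of $R_\alpha(\cdot,P_n)$ over $\mathcal{M}_{\widehat\theta_n,\mathcal{E}}$, and $p_{\theta_0}=dP_{\theta_0}/d\lambda$.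
   Context: Setting. $K\subset\mathbb{R}^m$ is compact, $\lambda$ is Lebesgue measure on $K$, $\Theta\subset\mathbb{R}^d$ is compact, $\alpha\in(0,1]$ is fixed, and $g=(g_1,\dots,g_l)^T:K\times\Theta\to\mathbb{R}^l$ with $l\le d$ and $g_1,\dots,g_l$ linearly independent. Assumptions on $g$: it is continuous on $\mathrm{int}(K)\times\mathrm{int}(\Theta)$; $\sup_{\theta\in\Theta}\sup_{x\in K}\|g(x,\theta)\|<\infty$; and $\sup_{x\in K}\|g(x,\theta_n)-g(x,\underline\theta)\|\to0$ whenever $\theta_n\to\underline\theta$. Function class. $E$ is a set of nonnegative functions in $\mathcal{C}_b(K)$ (bounded continuous functions on $K$), with metric $d(q,q')=\sup_{x\in K}|q(x)-q'(x)|$. Model. $\mathcal{M}^1_K$ is the set of probability measures supported on $K$, and $\mathcal{M}^1_K(\lambda)$ its subset of measures absolutely continuous with respect to $\lambda$. $\mathcal{E}$ is the class of nonnegative finite measures $Q$ on $K$ with density $q=dQ/d\lambda\in E$. For $\theta\in\Theta$, $\mathcal{M}_\theta=\{Q\in\mathcal{M}^1_K:\int g(x,\theta)\,dQ(x)=0\}$ and $\mathcal{M}_{\theta,\mathcal{E}}=\mathcal{M}_\theta\cap\mathcal{E}$, assumed nonempty; $\mathcal{M}=\bigcup_{\theta\in\Theta}\mathcal{M}_\theta$, $\mathcal{M}_{\mathcal{E}}=\bigcup_{\theta\in\Theta}\mathcal{M}_{\theta,\mathcal{E}}$. Densities of $Q,Q'$ are denoted $q,q'$; $d(\theta,\theta')$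 is the distance in $\mathbb{R}^d$. Divergence and criterion. For $Q,P$ absolutely continuous with respect to $\lambda$, with densities $q,p$, $$D_\alpha(Q,P)=\int\Big\{q^{\alpha+1}(x)-\Big(1+\tfrac1\alpha\Big)q^\alpha(x)p(x)+\tfrac1\alpha p^{\alpha+1}(x)\Big\}dx .$$ For $Q$ with density $q$ and any probability measure $P$ on $K$, $$R_\alpha(Q,P)=\int q^{\alpha+1}(x)\,dx-\Big(1+\tfrac1\alpha\Big)\int q^\alpha(x)\,dP(x),$$ so that $D_\alpha(Q,P)=R_\alpha(Q,P)+\frac1\alpha\int p^{\alpha+1}d\lambda$ when $P$ has density $p$. Sampling. $X_1,X_2,\dots$ are i.i.d. with distribution $P_0\in\mathcal{M}^1_K(\lambda)$ with density $p_0$; $P_n=\frac1n\sum_{i=1}^n\delta_{X_i}$. The quantity $D_\alpha(\mathcal{M},P_n)$ is the plug-in version, over the smooth model, of $\inf_\theta\inf_{Q\in\mathcal{M}_{\theta,\mathcal{E}}}D_\alpha(Q,P_0)$: $$D_\alpha(\mathcal{M},P_n)=\inf_{\theta\in\Theta}\inf_{Q\in\mathcal{M}_{\theta,\mathcal{E}}}R_\alpha(Q,P_n)+\tfrac1\alpha\int p_0^{\alpha+1}\,d\lambda .$$ Conditions. (E1) $\sup_{q\in E}\sup_{x\in K}|q(x)|<\infty$. (E2) There is $M<\infty$ with $|q^\alpha(x)-q^\alpha(y)|\le M|x-y|$ for all $q\in E$, $x,y\in K$, where moreover either (i) $\inf_{q\in E}\inf_{x\in K}q(x)>\gamma$ for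 some $\gamma>0$ and $q^\delta$ is Lipschitz uniformly over $q\in E$ for some $\delta\in(0,1]$, or (ii) $E$ has no such uniform positive lower bound and $q^\delta$ is Lipschitz uniformly over $q\in E$ for some $\delta$ with $0<\delta<\alpha$. (M1) $\mathcal{M}_\theta\cap\mathcal{M}_{\theta'}=\emptyset$ for $\theta\ne\theta'$. (M2) For each $\epsilon>0$ there is $\delta>0$ such that $d(\theta,\theta')>\epsilon$ implies $\inf\{d(q,q'):Q\in\mathcal{M}_{\theta,\mathcal{E}},Q'\in\mathcal{M}_{\theta',\mathcal{E}}\}>\delta$. (M3) $\inf_{Q\in\mathcal{M}_{\theta_0,\mathcal{E}}}D_\alpha(Q,P_0)<\inf_{Q\in\mathcal{M}_{\theta,\mathcal{E}}}D_\alpha(Q,P_0)$ for all $\theta\ne\theta_0$, whenever $P_0\in\mathcal{M}_{\theta_0}$. (M4) There is $C>0$, independent of $\theta,\theta'$, such that for every $\delta>0$, $\sup\{d(q,q'):Q\in\mathcal{M}_{\theta,\mathcal{E}},\,Q'\in\mathcal{M}_{\theta',\mathcal{E}},\,d(\theta,\theta')<\delta\}<C\delta$.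
   Formalization: The limits of D_α(M,P_n) and of d(q_θ̂n, p_θ0) are claimed only when P_0 is in M_E, with p_θ0 its density in E; for P_0 in M but not in M_E these two limits fail, and only θ̂_n → θ_0 is claimed. *)

theory Defs
  imports "HOL-Probability.Probability"
begin

definition borel_on :: "'a::euclidean_space set \<Rightarrow> 'a measure" where
  "borel_on K = restrict_space borel K"

definition lebesgue_K :: "'a::euclidean_space set \<Rightarrow> 'a measure" where
  "lebesgue_K K = restrict_space lborel K"

text \<open>Elements of the function class are total functions of which only the restriction to
  \<open>K\<close> matters; \<open>sup_dist K q q'\<close> is a genuine distance of those restrictions when \<open>K\<close> is
  nonempty and both functions are bounded on \<open>K\<close>.\<close>

definition nonneg_Cb :: "'a::euclidean_space set \<Rightarrow> ('a \<Rightarrow> real) set" where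
  "nonneg_Cb K = {q. continuous_on K q \<and> bounded (q ` K) \<and> (\<forall>x\<in>K. 0 \<le> q x)}"

definition sup_dist :: "'a set \<Rightarrow> ('a \<Rightarrow> real) \<Rightarrow> ('a \<Rightarrow> real) \<Rightarrow> real" where
  "sup_dist K q q' = (SUP x\<in>K. \<bar>q x - q' x\<bar>)"

definition prob_measures_on :: "'a::euclidean_space set \<Rightarrow> 'a measure set" where
  "prob_measures_on K = {Q. prob_space Q \<and> sets Q = sets (borel_on K)}"

definition smooth_measures :: "'a::euclidean_space set \<Rightarrow> ('a \<Rightarrow> real) set \<Rightarrow> 'a measure set" where
  "smooth_measures K E = {Q. finite_measure Q \<and> (\<exists>q\<in>E. Q = density (lebesgue_K K) (\<lambda>x. ennreal (q x)))}"

text \<open>Integrability is demanded explicitly because the Bochner integral of a non-integrable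
  function is \<open>0\<close>.\<close>

definition moment_model ::
  "'a::euclidean_space set \<Rightarrow> ('a \<Rightarrow> 'b \<Rightarrow> 'c::euclidean_space) \<Rightarrow> 'b \<Rightarrow> 'a measure set" where
  "moment_model K g \<theta> = {Q \<in> prob_measures_on K.
     integrable Q (\<lambda>x. g x \<theta>) \<and> (\<integral>x. g x \<theta> \<partial>Q) = 0}"

definition smooth_model ::
  "'a::euclidean_space set \<Rightarrow> ('a \<Rightarrow> 'b \<Rightarrow> 'c::euclidean_space) \<Rightarrow> ('a \<Rightarrow> real) set \<Rightarrow> 'b
     \<Rightarrow> 'a measure set" where
  "smooth_model K g E \<theta> = moment_model K g \<theta> \<inter> smooth_measures K E"

text \<open>Infima and suprema over \<open>Q \<in> smooth_model K g E \<theta>\<close> are taken over the densities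
  \<open>q \<in> E\<close> of such \<open>Q\<close>, since the sup distance and the integrals of \<open>q powr \<alpha>\<close> against
  empirical measures depend on \<open>q\<close> pointwise.\<close>

definition smooth_densities ::
  "'a::euclidean_space set \<Rightarrow> ('a \<Rightarrow> 'b \<Rightarrow> 'c::euclidean_space) \<Rightarrow> ('a \<Rightarrow> real) set \<Rightarrow> 'b
     \<Rightarrow> ('a \<Rightarrow> real) set" where
  "smooth_densities K g E \<theta> =
     {q \<in> E. density (lebesgue_K K) (\<lambda>x. ennreal (q x)) \<in> smooth_model K g E \<theta>}"

text \<open>For nonnegative \<open>q\<close> and \<open>p\<close> the integrand is nonnegative by Young's inequality, so no
  mass is lost in \<open>ennreal\<close>; the value is infinite when \<open>p powr (\<alpha> + 1)\<close> is not integrable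
  and \<open>q\<close> is bounded.\<close>

definition alpha_divergence ::
  "real \<Rightarrow> 'a::euclidean_space set \<Rightarrow> ('a \<Rightarrow> real) \<Rightarrow> ('a \<Rightarrow> real) \<Rightarrow> ennreal" where
  "alpha_divergence \<alpha> K q p =
     (\<integral>\<^sup>+x. ennreal (q x powr (\<alpha> + 1) - (1 + 1 / \<alpha>) * q x powr \<alpha> * p x
        + 1 / \<alpha> * p x powr (\<alpha> + 1)) \<partial>lebesgue_K K)"

definition alpha_criterion ::
  "real \<Rightarrow> 'a::euclidean_space set \<Rightarrow> ('a \<Rightarrow> real) \<Rightarrow> 'a measure \<Rightarrow> real" where
  "alpha_criterion \<alpha> K q P =
     (\<integral>x. q x powr (\<alpha> + 1) \<partial>lebesgue_K K) - (1 + 1 / \<alpha>) * (\<integral>x. q x powr \<alpha> \<partial>P)"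

definition profile_criterion ::
  "real \<Rightarrow> 'a::euclidean_space set \<Rightarrow> ('a \<Rightarrow> 'b \<Rightarrow> 'c::euclidean_space) \<Rightarrow> ('a \<Rightarrow> real) set
     \<Rightarrow> 'a measure \<Rightarrow> 'b \<Rightarrow> real" where
  "profile_criterion \<alpha> K g E P \<theta> = (INF q\<in>smooth_densities K g E \<theta>. alpha_criterion \<alpha> K q P)"

text \<open>The plug-in estimate of the divergence from the model: \<open>P\<close> is the empirical measure,
  \<open>p0\<close> the density of the sampling distribution. Its limit is the minimal divergence from the
  smooth model, which is positive in general when the sampling distribution satisfies the moment
  condition but has no density in \<open>E\<close>; hence the case distinction between the two models.\<close>

definition plugin_divergence ::
  "real \<Rightarrow> 'a::euclidean_space set \<Rightarrow> 'b set \<Rightarrow> ('a \<Rightarrow> 'b \<Rightarrow> 'c::euclidean_space)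
     \<Rightarrow> ('a \<Rightarrow> real) set \<Rightarrow> ('a \<Rightarrow> real) \<Rightarrow> 'a measure \<Rightarrow> real" where
  "plugin_divergence \<alpha> K \<Theta> g E p0 P =
     (INF \<theta>\<in>\<Theta>. profile_criterion \<alpha> K g E P \<theta>)
       + 1 / \<alpha> * (\<integral>x. p0 x powr (\<alpha> + 1) \<partial>lebesgue_K K)"

definition empirical_measure ::
  "'a::euclidean_space set \<Rightarrow> (nat \<Rightarrow> 'w \<Rightarrow> 'a) \<Rightarrow> nat \<Rightarrow> 'w \<Rightarrow> 'a measure" where
  "empirical_measure K X n \<omega> = distr (uniform_count_measure {1..n}) (borel_on K) (\<lambda>i. X i \<omega>)"

text \<open>Convergence in probability to a constant, with outer probability of the exceptional sets.
  For random variables this is the usual notion; for arbitrary functions (an argmin need not be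
  chosen measurably) it avoids the value \<open>0\<close> that \<open>measure\<close> assigns to nonmeasurable sets.\<close>

definition tendsto_in_prob ::
  "'w measure \<Rightarrow> (nat \<Rightarrow> 'w \<Rightarrow> 'z::metric_space) \<Rightarrow> 'z \<Rightarrow> bool" where
  "tendsto_in_prob S Z z \<longleftrightarrow> (\<forall>\<epsilon>>0. \<exists>A.
     (\<forall>n. A n \<in> sets S \<and> {\<omega> \<in> space S. dist (Z n \<omega>) z > \<epsilon>} \<subseteq> A n)
     \<and> (\<lambda>n. measure S (A n)) \<longlonglongrightarrow> 0)"

definition moment_function_assms ::
  "'a::euclidean_space set \<Rightarrow> 'b::euclidean_space set \<Rightarrow> ('a \<Rightarrow> 'b \<Rightarrow> 'c::euclidean_space) \<Rightarrow> bool" where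
  "moment_function_assms K \<Theta> g \<longleftrightarrow>
     (\<forall>c. (\<forall>x\<in>K. \<forall>\<theta>\<in>\<Theta>. c \<bullet> g x \<theta> = 0) \<longrightarrow> c = 0)
     \<and> continuous_on (interior K \<times> interior \<Theta>) (\<lambda>(x, \<theta>). g x \<theta>)
     \<and> (SUP \<theta>\<in>\<Theta>. SUP x\<in>K. ereal (norm (g x \<theta>))) < \<infinity>
     \<and> (\<forall>t \<theta>. (\<forall>n. t n \<in> \<Theta>) \<longrightarrow> \<theta> \<in> \<Theta> \<longrightarrow> t \<longlonglongrightarrow> \<theta> \<longrightarrow>
          (\<lambda>n. SUP x\<in>K. ereal (norm (g x (t n) - g x \<theta>))) \<longlonglongrightarrow> 0)"

definition cond_E1 :: "'a::euclidean_space set \<Rightarrow> ('a \<Rightarrow> real) set \<Rightarrow> bool" where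
  "cond_E1 K E \<longleftrightarrow> (SUP q\<in>E. SUP x\<in>K. ereal \<bar>q x\<bar>) < \<infinity>"

definition uniform_lower_bound :: "'a::euclidean_space set \<Rightarrow> ('a \<Rightarrow> real) set \<Rightarrow> bool" where
  "uniform_lower_bound K E \<longleftrightarrow> (\<exists>\<gamma>>0. (INF q\<in>E. INF x\<in>K. ereal (q x)) > ereal \<gamma>)"

definition powr_unif_lipschitz :: "'a::euclidean_space set \<Rightarrow> ('a \<Rightarrow> real) set \<Rightarrow> real \<Rightarrow> bool" where
  "powr_unif_lipschitz K E \<delta> \<longleftrightarrow> (\<exists>L. \<forall>q\<in>E. L-lipschitz_on K (\<lambda>x. q x powr \<delta>))"

definition cond_E2 :: "real \<Rightarrow> 'a::euclidean_space set \<Rightarrow> ('a \<Rightarrow> real) set \<Rightarrow> bool" where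
  "cond_E2 \<alpha> K E \<longleftrightarrow> powr_unif_lipschitz K E \<alpha> \<and>
     ((uniform_lower_bound K E \<and> (\<exists>\<delta>. 0 < \<delta> \<and> \<delta> \<le> 1 \<and> powr_unif_lipschitz K E \<delta>))
      \<or> (\<not> uniform_lower_bound K E \<and> (\<exists>\<delta>. 0 < \<delta> \<and> \<delta> < \<alpha> \<and> powr_unif_lipschitz K E \<delta>)))"

definition cond_M1 ::
  "'a::euclidean_space set \<Rightarrow> 'b set \<Rightarrow> ('a \<Rightarrow> 'b \<Rightarrow> 'c::euclidean_space) \<Rightarrow> bool" where
  "cond_M1 K \<Theta> g \<longleftrightarrow>
     (\<forall>\<theta>\<in>\<Theta>. \<forall>\<theta>'\<in>\<Theta>. \<theta> \<noteq> \<theta>' \<longrightarrow> moment_model K g \<theta> \<inter> moment_model K g \<theta>' = {})"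

definition cond_M2 ::
  "'a::euclidean_space set \<Rightarrow> 'b::metric_space set \<Rightarrow> ('a \<Rightarrow> 'b \<Rightarrow> 'c::euclidean_space)
     \<Rightarrow> ('a \<Rightarrow> real) set \<Rightarrow> bool" where
  "cond_M2 K \<Theta> g E \<longleftrightarrow>
     (\<forall>\<epsilon>>0. \<exists>\<delta>>0. \<forall>\<theta>\<in>\<Theta>. \<forall>\<theta>'\<in>\<Theta>. dist \<theta> \<theta>' > \<epsilon> \<longrightarrow>
        (INF q\<in>smooth_densities K g E \<theta>. INF q'\<in>smooth_densities K g E \<theta>'.
           ereal (sup_dist K q q')) > ereal \<delta>)"

definition cond_M3 ::
  "real \<Rightarrow> 'a::euclidean_space set \<Rightarrow> 'b set \<Rightarrow> ('a \<Rightarrow> 'b \<Rightarrow> 'c::euclidean_space)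
     \<Rightarrow> ('a \<Rightarrow> real) set \<Rightarrow> 'a measure \<Rightarrow> ('a \<Rightarrow> real) \<Rightarrow> bool" where
  "cond_M3 \<alpha> K \<Theta> g E P0 p0 \<longleftrightarrow>
     (\<forall>\<theta>0\<in>\<Theta>. P0 \<in> moment_model K g \<theta>0 \<longrightarrow> (\<forall>\<theta>\<in>\<Theta>. \<theta> \<noteq> \<theta>0 \<longrightarrow>
        (INF q\<in>smooth_densities K g E \<theta>0. alpha_divergence \<alpha> K q p0)
          < (INF q\<in>smooth_densities K g E \<theta>. alpha_divergence \<alpha> K q p0)))"

definition cond_M4 ::
  "'a::euclidean_space set \<Rightarrow> 'b::metric_space set \<Rightarrow> ('a \<Rightarrow> 'b \<Rightarrow> 'c::euclidean_space)
     \<Rightarrow> ('a \<Rightarrow> real) set \<Rightarrow> bool" where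
  "cond_M4 K \<Theta> g E \<longleftrightarrow>
     (\<exists>C>0. \<forall>\<delta>>0.
        Sup {ereal (sup_dist K q q') | q q' \<theta> \<theta>'. \<theta> \<in> \<Theta> \<and> \<theta>' \<in> \<Theta> \<and> dist \<theta> \<theta>' < \<delta>
               \<and> q \<in> smooth_densities K g E \<theta> \<and> q' \<in> smooth_densities K g E \<theta>'}
          < ereal (C * \<delta>))"

end

theory Submission
  imports Defs
begin

text \<open>Because \<open>cond_M4\<close> is required for every radius, letting the radius tend to
  \<open>dist \<theta> \<theta>'\<close> turns it into the Lipschitz bound
  \<open>sup_dist K q q' \<le> C * dist \<theta> \<theta>'\<close> between densities of the models at \<open>\<theta>\<close> and \<open>\<theta>'\<close>
  (\<open>cond_M4_lipschitz\<close>). At \<open>\<theta> = \<theta>'\<close> it says that every smooth model contains a single density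
  \<open>q \<theta>\<close>, as a function on \<open>K\<close>. So the inner infimum is trivial, the profile criterion is
  \<open>\<theta> \<mapsto> alpha_criterion \<alpha> K (q \<theta>) P\<close>, and the problem is that of an ordinary M-estimator over
  the compact set \<open>\<Theta>\<close>.

  Consistency then has the three classical ingredients.

  \<^item> Uniform convergence. The densities are uniformly bounded and depend on \<open>\<theta>\<close> in a Lipschitz
    way, and \<open>u \<mapsto> u powr \<alpha>\<close> is uniformly continuous on bounded intervals, so the functions
    \<open>x \<mapsto> q \<theta> x powr \<alpha>\<close> have finite nets for the sup norm on \<open>K\<close>. Hoeffding's inequality at
    each point of a net gives the law of large numbers uniformly in \<open>\<theta>\<close> (\<open>uniform_weak_law\<close>),
    and the first term of the criterion does not involve the sample.

  \<^item> Continuity of the limit \<open>\<theta> \<mapsto> alpha_criterion \<alpha> K (q \<theta>) P0\<close>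
    (\<open>continuous_on_alpha_criterion\<close>).

  \<^item> A unique minimum at \<open>\<theta>0\<close>. The divergence from \<open>P0\<close> equals the criterion plus a constant, so
    \<open>cond_M3\<close> transfers to the criterion. When \<open>p0 powr (\<alpha> + 1)\<close> is not integrable that constant
    is infinite, but then all divergences are infinite and the strict inequality cannot hold
    (\<open>alpha_criterion_less_of_divergence_less\<close>). By compactness the minimum is well separated.

  An approximate minimizer of the limit is therefore close to \<open>\<theta>0\<close>, and the argmin of the
  empirical criterion is such an approximate minimizer. The Lipschitz bound carries the convergence
  of the parameter over to the density. The minimal empirical criterion converges to the minimum
  of the limit, which the constant cancels when the truth has a density in \<open>E\<close>
  (\<open>alpha_criterion_at_truth\<close>).\<close>

section \<open>Events of probability tending to one\<close>

text \<open>``With high probability'': outer probability is used because the events below concern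
  argmins and suprema over \<open>\<Theta>\<close>, whose measurability is not assumed.\<close>

definition whp :: "'w measure \<Rightarrow> (nat \<Rightarrow> 'w \<Rightarrow> bool) \<Rightarrow> bool" where
  "whp S P \<longleftrightarrow> (\<exists>A. (\<forall>n. A n \<in> sets S \<and> {\<omega> \<in> space S. \<not> P n \<omega>} \<subseteq> A n)
     \<and> (\<lambda>n. measure S (A n)) \<longlonglongrightarrow> 0)"

lemma tendsto_in_prob_iff_whp:
  "tendsto_in_prob S Z z \<longleftrightarrow> (\<forall>\<epsilon>>0. whp S (\<lambda>n \<omega>. dist (Z n \<omega>) z \<le> \<epsilon>))"
  unfolding tendsto_in_prob_def whp_def by (simp add: not_le)

text \<open>Only sample sizes \<open>n \<ge> 1\<close> have to be considered: a limit ignores \<open>n = 0\<close>, where the empirical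
  measure is meaningless, and there the whole space serves as exceptional set.\<close>

lemma whp_mono:
  assumes "whp S P"
    and imp: "\<And>n \<omega>. n \<ge> 1 \<Longrightarrow> \<omega> \<in> space S \<Longrightarrow> P n \<omega> \<Longrightarrow> Q n \<omega>"
  shows "whp S Q"
proof -
  obtain A where A: "\<And>n. A n \<in> sets S" "\<And>n. {\<omega> \<in> space S. \<not> P n \<omega>} \<subseteq> A n"
    "(\<lambda>n. measure S (A n)) \<longlonglongrightarrow> 0"
    using assms(1) unfolding whp_def by blast
  define A' where "A' n = (if n = 0 then space S else A n)" for n
  have "(\<lambda>n. measure S (A' n)) \<longlonglongrightarrow> 0"
    by (rule Lim_transform_eventually[OF A(3)], rule eventually_mono[OF eventually_gt_at_top[of 0]])
       (simp add: A'_def)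
  moreover have "A' n \<in> sets S \<and> {\<omega> \<in> space S. \<not> Q n \<omega>} \<subseteq> A' n" for n
    using A(1,2)[of n] imp[of n] by (auto simp: A'_def)
  ultimately show ?thesis
    unfolding whp_def by blast
qed

lemma whp_finite_ball:
  assumes "finite_measure S" and "finite T" and "\<And>t. t \<in> T \<Longrightarrow> whp S (P t)"
  shows "whp S (\<lambda>n \<omega>. \<forall>t\<in>T. P t n \<omega>)"
proof -
  interpret finite_measure S by fact
  have "\<forall>t\<in>T. \<exists>A. (\<forall>n. A n \<in> sets S \<and> {\<omega> \<in> space S. \<not> P t n \<omega>} \<subseteq> A n)
     \<and> (\<lambda>n. measure S (A n)) \<longlonglongrightarrow> 0"
    using assms(3) unfolding whp_def by blast
  then obtain A where A: "\<And>t n. t \<in> T \<Longrightarrow> A t n \<in> sets S"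
    "\<And>t n. t \<in> T \<Longrightarrow> {\<omega> \<in> space S. \<not> P t n \<omega>} \<subseteq> A t n"
    "\<And>t. t \<in> T \<Longrightarrow> (\<lambda>n. measure S (A t n)) \<longlonglongrightarrow> 0"
    by metis
  have "(\<lambda>n. measure S (\<Union>t\<in>T. A t n)) \<longlonglongrightarrow> 0"
  proof (rule tendsto_sandwich[OF _ _ tendsto_const])
    show "\<forall>\<^sub>F n in sequentially. measure S (\<Union>t\<in>T. A t n) \<le> (\<Sum>t\<in>T. measure S (A t n))"
      using A(1) assms(2) by (intro always_eventually allI finite_measure_subadditive_finite) auto
    show "(\<lambda>n. \<Sum>t\<in>T. measure S (A t n)) \<longlonglongrightarrow> 0"
      using tendsto_sum[of T "\<lambda>t n. measure S (A t n)" "\<lambda>_. 0"] A(3) by simp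
  qed simp
  moreover have "(\<Union>t\<in>T. A t n) \<in> sets S" for n
    using A(1) assms(2) by blast
  moreover have "{\<omega> \<in> space S. \<not> (\<forall>t\<in>T. P t n \<omega>)} \<subseteq> (\<Union>t\<in>T. A t n)" for n
    using A(2) by fastforce
  ultimately show ?thesis
    unfolding whp_def by (intro exI[of _ "\<lambda>n. \<Union>t\<in>T. A t n"] conjI allI)
qed

section \<open>A uniform law of large numbers\<close>

lemma space_borel_on [simp]: "space (borel_on K) = K"
  by (simp add: borel_on_def space_restrict_space)

lemma prob_space_empirical_measure:
  assumes "n \<ge> 1" and "\<And>i. i \<ge> 1 \<Longrightarrow> X i \<omega> \<in> K"
  shows "prob_space (empirical_measure K X n \<omega>)"
  unfolding empirical_measure_def using assms
  by (intro prob_space.prob_space_distr prob_space_uniform_count_measure)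
     (auto simp: measurable_def space_uniform_count_measure sets_uniform_count_measure)

lemma integral_empirical_measure:
  fixes f :: "'a::euclidean_space \<Rightarrow> real"
  assumes f: "f \<in> borel_measurable (borel_on K)" and X: "\<And>i. i \<ge> 1 \<Longrightarrow> X i \<omega> \<in> K"
  shows "(\<integral>x. f x \<partial>empirical_measure K X n \<omega>) = (\<Sum>i\<in>{1..n}. f (X i \<omega>)) / real n"
proof -
  have "(\<lambda>i. X i \<omega>) \<in> uniform_count_measure {1..n} \<rightarrow>\<^sub>M borel_on K"
    using X by (auto simp: measurable_def space_uniform_count_measure sets_uniform_count_measure)
  then show ?thesis
    unfolding empirical_measure_def using f
    by (simp add: integral_distr integral_uniform_count_measure)
qed

lemma abs_integral_diff_le:
  fixes f f' :: "'a \<Rightarrow> real"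
  assumes "finite_measure M" "integrable M f" "integrable M f'"
    and le: "\<And>x. x \<in> space M \<Longrightarrow> \<bar>f x - f' x\<bar> \<le> \<eta>"
  shows "\<bar>(\<integral>x. f x \<partial>M) - (\<integral>x. f' x \<partial>M)\<bar> \<le> \<eta> * measure M (space M)"
proof -
  interpret finite_measure M by fact
  have "\<bar>(\<integral>x. f x \<partial>M) - (\<integral>x. f' x \<partial>M)\<bar> = \<bar>\<integral>x. f x - f' x \<partial>M\<bar>"
    using assms by simp
  also have "\<dots> \<le> (\<integral>x. \<bar>f x - f' x\<bar> \<partial>M)"
    by (rule integral_abs_bound)
  also have "\<dots> \<le> (\<integral>x. \<eta> \<partial>M)"
    using assms by (intro integral_mono) auto
  finally show ?thesis by (simp add: mult.commute)
qed

text \<open>Hoeffding's inequality bounds the probability of a deviation by a geometric sequence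
  in the sample size.\<close>

lemma weak_law_bounded:
  fixes f :: "'a::euclidean_space \<Rightarrow> real"
  assumes S: "prob_space S" and indep: "prob_space.indep_vars S (\<lambda>_. borel_on K) X {1..}"
    and distr: "\<forall>i\<ge>1. distr S (borel_on K) (X i) = P0"
    and f: "f \<in> borel_measurable (borel_on K)" and B: "\<And>x. x \<in> K \<Longrightarrow> \<bar>f x\<bar> \<le> B"
    and "\<epsilon> > 0"
  shows "whp S (\<lambda>n \<omega>. \<bar>(\<integral>x. f x \<partial>empirical_measure K X n \<omega>) - (\<integral>x. f x \<partial>P0)\<bar> \<le> \<epsilon>)"
proof -
  interpret prob_space S by fact
  have X[measurable]: "X i \<in> S \<rightarrow>\<^sub>M borel_on K" if "i \<ge> 1" for i
    using indep that unfolding indep_vars_def by auto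
  have XK: "X i \<omega> \<in> K" if "i \<ge> 1" "\<omega> \<in> space S" for i \<omega>
    using measurable_space[OF X[OF that(1)] that(2)] by simp
  have fX[measurable]: "(\<lambda>\<omega>. f (X i \<omega>)) \<in> borel_measurable S" if "i \<ge> 1" for i
    using measurable_compose[OF X[OF that] f] .
  have X1[measurable]: "X (Suc 0) \<in> S \<rightarrow>\<^sub>M borel_on K"
    using X[of 1] by simp
  \<comment> \<open>One is added because Hoeffding's inequality needs an interval of positive length.\<close>
  define b where "b = \<bar>B\<bar> + 1"
  define A where "A n = {\<omega> \<in> space S.
      \<epsilon> \<le> \<bar>(\<Sum>i\<in>{1..n}. f (X i \<omega>)) / real n - (\<integral>x. f x \<partial>P0)\<bar>}" for n :: nat
  have A: "A n \<in> sets S" for n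
  proof -
    have [measurable]: "(\<lambda>\<omega>. \<Sum>i\<in>{1..n}. f (X i \<omega>)) \<in> borel_measurable S"
      by (intro borel_measurable_sum) auto
    show ?thesis unfolding A_def by measurable
  qed
  have mean: "(\<integral>x. f x \<partial>P0) = expectation (\<lambda>\<omega>. f (X 1 \<omega>))"
    using distr f by (subst integral_distr[OF X[of 1], symmetric]) auto
  have le: "measure S (A n) \<le> 2 * exp (-2 * real n * \<epsilon>\<^sup>2 / (b - (-b))\<^sup>2)" if n: "n \<ge> 1" for n
  proof -
    interpret Hoeffding_ineq_iid S "{1..n}" "\<lambda>i \<omega>. f (X i \<omega>)" "\<lambda>\<omega>. f (X 1 \<omega>)" "-b" b
      "(\<integral>x. f x \<partial>P0)"
    proof unfold_locales
      show "indep_vars (\<lambda>_. borel) (\<lambda>i \<omega>. f (X i \<omega>)) {1..n}"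
        by (rule indep_vars_compose2[OF indep_vars_subset[OF indep]]) (use f in auto)
      show "distr S borel (\<lambda>\<omega>. f (X i \<omega>)) = distr S borel (\<lambda>\<omega>. f (X 1 \<omega>))"
        if "i \<in> {1..n}" for i
      proof -
        have "distr S borel (\<lambda>\<omega>. f (X j \<omega>)) = distr P0 borel f" if "j \<ge> 1" for j
          using distr_distr[OF f X[OF that]] distr that by (simp add: comp_def)
        from this[of i] this[of 1] that show ?thesis by simp
      qed
      have "f (X 1 \<omega>) \<in> {-b..b}" if "\<omega> \<in> space S" for \<omega>
        using B[OF XK[OF _ that, of 1]] by (auto simp: b_def abs_le_iff)
      then show "AE \<omega> in S. f (X 1 \<omega>) \<in> {-b..b}" by simp
      show "(\<integral>x. f x \<partial>P0) \<equiv> expectation (\<lambda>\<omega>. f (X 1 \<omega>))"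
        by (rule eq_reflection) (rule mean)
    qed (auto simp: fX)
    show ?thesis
      using Hoeffding_ineq_abs_ge'[of \<epsilon>] n \<open>\<epsilon> > 0\<close> unfolding A_def b_def by simp
  qed
  have "(\<lambda>n. measure S (A n)) \<longlonglongrightarrow> 0"
  proof (rule tendsto_sandwich[OF _ _ tendsto_const])
    show "\<forall>\<^sub>F n in sequentially. measure S (A n) \<le> 2 * exp (-2 * real n * \<epsilon>\<^sup>2 / (b - (-b))\<^sup>2)"
      using eventually_ge_at_top[of 1] by eventually_elim (rule le)
    define c where "c = 2 * \<epsilon>\<^sup>2 / (b - (-b))\<^sup>2"
    have "c > 0" using \<open>\<epsilon> > 0\<close> by (auto simp: c_def b_def intro!: divide_pos_pos)
    have "((\<lambda>n. 2 * exp (- c) ^ n) \<longlongrightarrow> 2 * 0) sequentially"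
      using \<open>c > 0\<close> by (intro tendsto_mult tendsto_const LIMSEQ_realpow_zero) auto
    moreover have "exp (- c) ^ n = exp (-2 * real n * \<epsilon>\<^sup>2 / (b - (-b))\<^sup>2)" for n
      by (simp add: c_def flip: exp_of_nat_mult)
    ultimately show "(\<lambda>n. 2 * exp (-2 * real n * \<epsilon>\<^sup>2 / (b - (-b))\<^sup>2)) \<longlonglongrightarrow> 0" by simp
  qed simp
  then have "whp S (\<lambda>n \<omega>. \<omega> \<notin> A n)"
    unfolding whp_def using A by (intro exI[of _ A]) auto
  then show ?thesis
    by (rule whp_mono) (use f XK in \<open>auto simp: integral_empirical_measure A_def\<close>)
qed

text \<open>Replacing \<open>f \<theta>\<close> by the nearest element of a finite \<open>\<epsilon> / 3\<close>-net changes both its empirical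
  mean and its mean by at most \<open>\<epsilon> / 3\<close>, so it suffices to control the finitely many deviations
  at the points of the net.\<close>

lemma uniform_weak_law:
  fixes f :: "'b \<Rightarrow> 'a::euclidean_space \<Rightarrow> real"
  assumes S: "prob_space S" and indep: "prob_space.indep_vars S (\<lambda>_. borel_on K) X {1..}"
    and distr: "\<forall>i\<ge>1. distr S (borel_on K) (X i) = P0"
    and f: "\<And>\<theta>. \<theta> \<in> \<Theta> \<Longrightarrow> f \<theta> \<in> borel_measurable (borel_on K)"
    and B: "\<And>\<theta> x. \<theta> \<in> \<Theta> \<Longrightarrow> x \<in> K \<Longrightarrow> \<bar>f \<theta> x\<bar> \<le> B"
    and net: "\<And>\<eta>. \<eta> > 0 \<Longrightarrow>
      \<exists>T\<subseteq>\<Theta>. finite T \<and> (\<forall>\<theta>\<in>\<Theta>. \<exists>t\<in>T. \<forall>x\<in>K. \<bar>f \<theta> x - f t x\<bar> \<le> \<eta>)"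
    and "\<epsilon> > 0"
  shows "whp S (\<lambda>n \<omega>. \<forall>\<theta>\<in>\<Theta>.
    \<bar>(\<integral>x. f \<theta> x \<partial>empirical_measure K X n \<omega>) - (\<integral>x. f \<theta> x \<partial>P0)\<bar> \<le> \<epsilon>)"
proof -
  interpret prob_space S by fact
  have X: "X i \<in> S \<rightarrow>\<^sub>M borel_on K" if "i \<ge> 1" for i
    using indep that unfolding indep_vars_def by auto
  have XK: "X i \<omega> \<in> K" if "i \<ge> 1" "\<omega> \<in> space S" for i \<omega>
    using measurable_space[OF X[OF that(1)] that(2)] by simp
  have P0: "prob_space P0" "sets P0 = sets (borel_on K)"
    using prob_space_distr[OF X[of 1]] by (simp_all flip: distr[rule_format, of 1])
  obtain T where T: "T \<subseteq> \<Theta>" "finite T"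
    and close: "\<And>\<theta>. \<theta> \<in> \<Theta> \<Longrightarrow> \<exists>t\<in>T. \<forall>x\<in>K. \<bar>f \<theta> x - f t x\<bar> \<le> \<epsilon> / 3"
    using net[of "\<epsilon> / 3"] \<open>\<epsilon> > 0\<close> by auto
  have near: "\<bar>(\<integral>x. f \<theta> x \<partial>Q) - (\<integral>x. f t x \<partial>Q)\<bar> \<le> \<epsilon> / 3"
    if Q: "prob_space Q" "sets Q = sets (borel_on K)" and "\<theta> \<in> \<Theta>" "t \<in> \<Theta>"
      and "\<forall>x\<in>K. \<bar>f \<theta> x - f t x\<bar> \<le> \<epsilon> / 3" for Q \<theta> t
  proof -
    interpret Q: prob_space Q by fact
    have K: "space Q = K" using sets_eq_imp_space_eq[OF Q(2)] by simp
    have int: "integrable Q (f s)" if "s \<in> \<Theta>" for s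
      using B[OF that] f[OF that] K
      by (intro Q.integrable_const_bound[of _ B]) (auto simp: measurable_cong_sets[OF Q(2) refl])
    have "\<bar>(\<integral>x. f \<theta> x \<partial>Q) - (\<integral>x. f t x \<partial>Q)\<bar> \<le> \<epsilon> / 3 * measure Q (space Q)"
      by (rule abs_integral_diff_le[OF Q.finite_measure_axioms int[OF that(3)] int[OF that(4)]])
         (use that(5) K in blast)
    then show ?thesis
      by (simp add: Q.prob_space)
  qed
  have "whp S (\<lambda>n \<omega>. \<forall>t\<in>T.
      \<bar>(\<integral>x. f t x \<partial>empirical_measure K X n \<omega>) - (\<integral>x. f t x \<partial>P0)\<bar> \<le> \<epsilon> / 3)"
  proof (rule whp_finite_ball[OF finite_measure_axioms T(2)])
    fix t assume "t \<in> T"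
    then have "t \<in> \<Theta>" using T(1) by blast
    then show "whp S (\<lambda>n \<omega>.
        \<bar>(\<integral>x. f t x \<partial>empirical_measure K X n \<omega>) - (\<integral>x. f t x \<partial>P0)\<bar> \<le> \<epsilon> / 3)"
      using \<open>\<epsilon> > 0\<close> by (intro weak_law_bounded[OF S indep distr f B]) simp_all
  qed
  then show ?thesis
  proof (rule whp_mono, intro ballI)
    fix n \<omega> \<theta>
    assume n: "1 \<le> n" and \<omega>: "\<omega> \<in> space S" and \<theta>: "\<theta> \<in> \<Theta>"
      and dev: "\<forall>t\<in>T. \<bar>(\<integral>x. f t x \<partial>empirical_measure K X n \<omega>) - (\<integral>x. f t x \<partial>P0)\<bar> \<le> \<epsilon> / 3"
    obtain t where t: "t \<in> T" "\<forall>x\<in>K. \<bar>f \<theta> x - f t x\<bar> \<le> \<epsilon> / 3"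
      using close[OF \<theta>] by blast
    have Pn: "prob_space (empirical_measure K X n \<omega>)"
      using n XK[OF _ \<omega>] by (intro prob_space_empirical_measure)
    have "\<bar>(\<integral>x. f \<theta> x \<partial>empirical_measure K X n \<omega>) - (\<integral>x. f t x \<partial>empirical_measure K X n \<omega>)\<bar> \<le> \<epsilon> / 3"
      using t T \<theta> by (intro near Pn) (auto simp: empirical_measure_def)
    moreover have "\<bar>(\<integral>x. f \<theta> x \<partial>P0) - (\<integral>x. f t x \<partial>P0)\<bar> \<le> \<epsilon> / 3"
      using t T \<theta> by (intro near P0) auto
    moreover note dev[rule_format, OF t(1)]
    ultimately show "\<bar>(\<integral>x. f \<theta> x \<partial>empirical_measure K X n \<omega>) - (\<integral>x. f \<theta> x \<partial>P0)\<bar> \<le> \<epsilon>"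
      by linarith
  qed
qed

section \<open>The criterion and the divergence\<close>

lemma space_lebesgue_K [simp]: "space (lebesgue_K K) = K"
  by (simp add: lebesgue_K_def space_restrict_space)

lemma sets_lebesgue_K: "sets (lebesgue_K K) = sets (borel_on K)"
  by (simp add: lebesgue_K_def borel_on_def sets_restrict_space)

lemma finite_measure_lebesgue_K:
  assumes "compact K"
  shows "finite_measure (lebesgue_K K)"
  unfolding lebesgue_K_def
  by (intro finite_measureI)
     (use assms emeasure_compact_finite[of K] in
       \<open>simp add: emeasure_restrict_space borel_compact space_restrict_space less_top\<close>)

lemma nonneg_Cb_measurable:
  assumes "q \<in> nonneg_Cb K"
  shows "q \<in> borel_measurable (borel_on K)"
  using assms unfolding nonneg_Cb_def borel_on_def
  by (auto intro: borel_measurable_continuous_on_restrict)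

lemma nonneg_Cb_powr_integrable:
  assumes q: "q \<in> nonneg_Cb K" and M: "finite_measure M" "sets M = sets (borel_on K)" and "a \<ge> 0"
  shows "integrable M (\<lambda>x. q x powr a)"
proof -
  interpret finite_measure M by fact
  have K: "space M = K" using sets_eq_imp_space_eq[OF M(2)] by simp
  obtain B where "\<forall>y\<in>q ` K. norm y \<le> B"
    using q unfolding nonneg_Cb_def bounded_iff by blast
  then have B: "\<bar>q x\<bar> \<le> B" if "x \<in> K" for x
    using that by simp
  have [measurable]: "q \<in> borel_measurable M"
    using nonneg_Cb_measurable[OF q] by (simp add: measurable_cong_sets[OF M(2) refl])
  have "norm (q x powr a) \<le> B powr a" if "x \<in> K" for x
    using B[OF that] q that \<open>a \<ge> 0\<close> by (auto simp: nonneg_Cb_def intro!: powr_mono2)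
  then show ?thesis
    using K by (intro integrable_const_bound[of _ "B powr a"]) auto
qed

lemma alpha_criterion_cong:
  assumes "\<And>x. x \<in> K \<Longrightarrow> q x = q' x" and "space P = K"
  shows "alpha_criterion \<alpha> K q P = alpha_criterion \<alpha> K q' P"
proof -
  have "(\<integral>x. q x powr a \<partial>M) = (\<integral>x. q' x powr a \<partial>M)" if "space M = K" for M a
    using assms(1) that by (intro Bochner_Integration.integral_cong) auto
  from this[of "lebesgue_K K" "\<alpha> + 1"] this[OF assms(2), of \<alpha>] show ?thesis
    by (simp add: alpha_criterion_def)
qed

text \<open>This is Young's inequality for \<open>u powr \<alpha>\<close> and \<open>v\<close> with the conjugate exponents
  \<open>(\<alpha> + 1) / \<alpha>\<close> and \<open>\<alpha> + 1\<close>, multiplied by \<open>1 + 1 / \<alpha>\<close>.\<close>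

lemma alpha_divergence_integrand_nonneg:
  fixes u v \<alpha> :: real
  assumes "\<alpha> > 0" "u \<ge> 0" "v \<ge> 0"
  shows "0 \<le> u powr (\<alpha> + 1) - (1 + 1 / \<alpha>) * u powr \<alpha> * v + 1 / \<alpha> * v powr (\<alpha> + 1)"
proof -
  have "u powr \<alpha> * v \<le> (u powr \<alpha>) powr ((\<alpha> + 1) / \<alpha>) / ((\<alpha> + 1) / \<alpha>) + v powr (\<alpha> + 1) / (\<alpha> + 1)"
    using assms by (intro Youngs_inequality) (auto simp: field_simps)
  also have "(u powr \<alpha>) powr ((\<alpha> + 1) / \<alpha>) = u powr (\<alpha> + 1)"
    using assms by (simp add: powr_powr)
  finally have "(1 + 1 / \<alpha>) * (u powr \<alpha> * v)
      \<le> (1 + 1 / \<alpha>) * (u powr (\<alpha> + 1) / ((\<alpha> + 1) / \<alpha>) + v powr (\<alpha> + 1) / (\<alpha> + 1))"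
    using assms by (intro mult_left_mono) auto
  also have "\<dots> = u powr (\<alpha> + 1) + 1 / \<alpha> * v powr (\<alpha> + 1)"
  proof -
    have "(1 + 1 / \<alpha>) * (s / ((\<alpha> + 1) / \<alpha>) + t / (\<alpha> + 1)) = s + 1 / \<alpha> * t" for s t
    proof -
      have "1 + 1 / \<alpha> = (\<alpha> + 1) / \<alpha>" "\<alpha> + 1 \<noteq> 0" using assms by (simp_all add: field_simps)
      then show ?thesis using assms by (simp only: distrib_left) simp
    qed
    then show ?thesis .
  qed
  finally show ?thesis by (simp add: mult.assoc)
qed

text \<open>Of the three terms of the integrand of the divergence, the first two are integrable for bounded
  \<open>q\<close> and yield the criterion. The third does not depend on \<open>q\<close>, so it alone decides whether the
  divergence is finite.\<close>

lemma alpha_divergence_eq_criterion: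
  assumes "compact K" "0 < \<alpha>" and q: "q \<in> nonneg_Cb K"
    and p0: "p0 \<in> borel_measurable (lebesgue_K K)" "\<forall>x\<in>K. 0 \<le> p0 x"
    and P0: "P0 = density (lebesgue_K K) (\<lambda>x. ennreal (p0 x))" "prob_space P0"
  shows "integrable (lebesgue_K K) (\<lambda>x. p0 x powr (\<alpha> + 1)) \<Longrightarrow>
      alpha_divergence \<alpha> K q p0
        = ennreal (alpha_criterion \<alpha> K q P0 + 1 / \<alpha> * (\<integral>x. p0 x powr (\<alpha> + 1) \<partial>lebesgue_K K))
      \<and> 0 \<le> alpha_criterion \<alpha> K q P0 + 1 / \<alpha> * (\<integral>x. p0 x powr (\<alpha> + 1) \<partial>lebesgue_K K)"
    (is "?int \<Longrightarrow> ?eq \<and> ?nonneg")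
  and "\<not> integrable (lebesgue_K K) (\<lambda>x. p0 x powr (\<alpha> + 1)) \<Longrightarrow> alpha_divergence \<alpha> K q p0 = \<infinity>"
proof -
  let ?M = "lebesgue_K K"
  interpret P0: prob_space P0 by fact
  note [measurable] = p0(1)
  have q_meas[measurable]: "q \<in> borel_measurable ?M"
    using nonneg_Cb_measurable[OF q] by (simp add: measurable_cong_sets[OF sets_lebesgue_K refl])
  define h where "h x = q x powr (\<alpha> + 1) - (1 + 1 / \<alpha>) * q x powr \<alpha> * p0 x
      + 1 / \<alpha> * p0 x powr (\<alpha> + 1)" for x
  have h_meas[measurable]: "h \<in> borel_measurable ?M"
    unfolding h_def by measurable
  have h_nonneg: "0 \<le> h x" if "x \<in> K" for x
    unfolding h_def using alpha_divergence_integrand_nonneg[of \<alpha> "q x" "p0 x"] assms that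
    by (auto simp: nonneg_Cb_def)
  have D: "alpha_divergence \<alpha> K q p0 = (\<integral>\<^sup>+x. ennreal (h x) \<partial>?M)"
    by (simp add: alpha_divergence_def h_def)
  have int_q: "integrable ?M (\<lambda>x. q x powr (\<alpha> + 1))"
    using nonneg_Cb_powr_integrable[OF q finite_measure_lebesgue_K[OF \<open>compact K\<close>] sets_lebesgue_K]
      \<open>0 < \<alpha>\<close> by simp
  have "sets P0 = sets (borel_on K)" by (simp add: P0 sets_lebesgue_K)
  then have "integrable P0 (\<lambda>x. q x powr \<alpha>)"
    using nonneg_Cb_powr_integrable[OF q P0.finite_measure_axioms] \<open>0 < \<alpha>\<close> by simp
  then have int_qp: "integrable ?M (\<lambda>x. q x powr \<alpha> * p0 x)"
    unfolding P0 using p0 by (subst (asm) integrable_density) (auto simp: mult.commute)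
  have "(\<integral>x. q x powr \<alpha> \<partial>P0) = (\<integral>x. q x powr \<alpha> * p0 x \<partial>?M)"
    unfolding P0 using p0 by (subst integral_density) (auto simp: mult.commute)
  note criterion = alpha_criterion_def[of \<alpha> K q P0, unfolded this]
  show "?eq \<and> ?nonneg" if ?int
  proof -
    have "integrable ?M h"
      unfolding h_def using int_q int_qp that by (simp add: mult.assoc)
    moreover have "(\<integral>x. h x \<partial>?M) = alpha_criterion \<alpha> K q P0 + 1 / \<alpha> * (\<integral>x. p0 x powr (\<alpha> + 1) \<partial>?M)"
      unfolding h_def criterion using int_q int_qp that by (simp add: mult.assoc)
    moreover have "0 \<le> (\<integral>x. h x \<partial>?M)"
      using h_nonneg by (intro integral_nonneg_AE) auto
    ultimately show ?thesis
      unfolding D using h_nonneg by (subst nn_integral_eq_integral) auto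
  qed
  show "alpha_divergence \<alpha> K q p0 = \<infinity>" if "\<not> ?int"
  proof (rule ccontr)
    assume "alpha_divergence \<alpha> K q p0 \<noteq> \<infinity>"
    then have "integrable ?M h"
      using h_nonneg unfolding D by (intro integrableI_nonneg) (auto simp: less_top)
    then have "integrable ?M (\<lambda>x. \<alpha> * (h x - q x powr (\<alpha> + 1) + (1 + 1 / \<alpha>) * (q x powr \<alpha> * p0 x)))"
      using int_q int_qp by simp
    moreover have "\<alpha> * (h x - q x powr (\<alpha> + 1) + (1 + 1 / \<alpha>) * (q x powr \<alpha> * p0 x))
        = p0 x powr (\<alpha> + 1)" for x
      using \<open>0 < \<alpha>\<close> by (simp add: h_def mult.assoc)
    ultimately show False using that by simp
  qed
qed

lemma alpha_criterion_less_of_divergence_less: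
  assumes "compact K" "0 < \<alpha>" and q: "q \<in> nonneg_Cb K" and q': "q' \<in> nonneg_Cb K"
    and p0: "p0 \<in> borel_measurable (lebesgue_K K)" "\<forall>x\<in>K. 0 \<le> p0 x"
    and P0: "P0 = density (lebesgue_K K) (\<lambda>x. ennreal (p0 x))" "prob_space P0"
    and less: "alpha_divergence \<alpha> K q p0 < alpha_divergence \<alpha> K q' p0"
  shows "alpha_criterion \<alpha> K q P0 < alpha_criterion \<alpha> K q' P0"
proof (cases "integrable (lebesgue_K K) (\<lambda>x. p0 x powr (\<alpha> + 1))")
  case True
  show ?thesis
    using less alpha_divergence_eq_criterion(1)[OF assms(1,2) q p0 P0 True]
      alpha_divergence_eq_criterion(1)[OF assms(1,2) q' p0 P0 True]
    by (auto simp: ennreal_less_iff)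
next
  case False
  show ?thesis
    using less alpha_divergence_eq_criterion(2)[OF assms(1,2) q p0 P0 False] by simp
qed

text \<open>This is \<open>alpha_divergence \<alpha> K p p = 0\<close> in terms of the criterion: \<open>p0\<close> coincides almost
  everywhere with the bounded function \<open>p\<close>, hence the constant is finite and all three integrals
  are multiples of that of \<open>p powr (\<alpha> + 1)\<close>.\<close>

lemma alpha_criterion_at_truth:
  assumes "compact K" "0 < \<alpha>" and p: "p \<in> nonneg_Cb K"
    and p0: "p0 \<in> borel_measurable (lebesgue_K K)" "\<forall>x\<in>K. 0 \<le> p0 x"
    and P0: "P0 = density (lebesgue_K K) (\<lambda>x. ennreal (p0 x))"
      "P0 = density (lebesgue_K K) (\<lambda>x. ennreal (p x))"
  shows "alpha_criterion \<alpha> K p P0 + 1 / \<alpha> * (\<integral>x. p0 x powr (\<alpha> + 1) \<partial>lebesgue_K K) = 0"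
proof -
  let ?M = "lebesgue_K K"
  interpret finite_measure ?M by (rule finite_measure_lebesgue_K) fact
  have [measurable]: "p \<in> borel_measurable ?M" "p0 \<in> borel_measurable ?M"
    using nonneg_Cb_measurable[OF p] p0 by (auto simp: measurable_cong_sets[OF sets_lebesgue_K refl])
  have p_nonneg: "0 \<le> p x" if "x \<in> K" for x
    using p that by (simp add: nonneg_Cb_def)
  have "AE x in ?M. ennreal (p x) = ennreal (p0 x)"
    using P0 by (intro density_unique) auto
  then have "AE x in ?M. p x = p0 x"
  proof (rule AE_mp, intro AE_I2 impI)
    fix x assume "x \<in> space ?M" "ennreal (p x) = ennreal (p0 x)"
    then show "p x = p0 x" using p_nonneg p0(2) by simp
  qed
  then have "(\<integral>x. p0 x powr (\<alpha> + 1) \<partial>?M) = (\<integral>x. p x powr (\<alpha> + 1) \<partial>?M)"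
    by (intro integral_cong_AE) auto
  moreover have "(\<integral>x. p x powr \<alpha> \<partial>P0) = (\<integral>x. p x powr (\<alpha> + 1) \<partial>?M)"
  proof -
    have "(\<integral>x. p x powr \<alpha> \<partial>P0) = (\<integral>x. p x * p x powr \<alpha> \<partial>?M)"
      unfolding P0(2) using p_nonneg by (subst integral_density) auto
    also have "\<dots> = (\<integral>x. p x powr (\<alpha> + 1) \<partial>?M)"
      using p_nonneg by (intro Bochner_Integration.integral_cong) (auto simp: powr_add powr_one)
    finally show ?thesis .
  qed
  ultimately show ?thesis
    by (simp add: alpha_criterion_def algebra_simps)
qed

section \<open>The smooth model as a Lipschitz family of densities\<close>

lemma cond_E1_bounded:
  assumes "cond_E1 K E" and "E \<subseteq> nonneg_Cb K"
  shows "\<exists>B. \<forall>q\<in>E. \<forall>x\<in>K. q x \<in> {0..B}"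
proof -
  obtain B :: nat where B: "(SUP q\<in>E. SUP x\<in>K. ereal \<bar>q x\<bar>) < ereal (real B)"
    using assms(1) unfolding cond_E1_def by (metis less_PInf_Ex_of_nat less_irrefl)
  have "q x \<in> {0..real B}" if "q \<in> E" "x \<in> K" for q x
  proof -
    have "ereal \<bar>q x\<bar> \<le> (SUP q\<in>E. SUP x\<in>K. ereal \<bar>q x\<bar>)"
      using that by (meson SUP_upper SUP_upper2)
    also note B
    finally show ?thesis using assms(2) that by (auto simp: nonneg_Cb_def)
  qed
  then show ?thesis by blast
qed

lemma abs_diff_le_sup_dist:
  assumes "q \<in> nonneg_Cb K" "q' \<in> nonneg_Cb K" "x \<in> K"
  shows "\<bar>q x - q' x\<bar> \<le> sup_dist K q q'"
proof -
  have "bounded ((\<lambda>x. q x - q' x) ` K)"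
    using assms by (intro bounded_minus_comp) (auto simp: nonneg_Cb_def)
  then have "bdd_above ((\<lambda>x. \<bar>q x - q' x\<bar>) ` K)"
    by (auto simp: bounded_iff bdd_above_def)
  then show ?thesis
    unfolding sup_dist_def using assms(3) by (intro cSUP_upper)
qed

text \<open>Use the condition with a radius slightly above \<open>dist \<theta> \<theta>'\<close>. For \<open>\<theta> = \<theta>'\<close> the
  radius can be arbitrarily small, which makes the density in each model unique on \<open>K\<close>.\<close>

lemma cond_M4_lipschitz:
  assumes "cond_M4 K \<Theta> g E"
  shows "\<exists>C>0. \<forall>\<theta>\<in>\<Theta>. \<forall>\<theta>'\<in>\<Theta>. \<forall>q\<in>smooth_densities K g E \<theta>. \<forall>q'\<in>smooth_densities K g E \<theta>'.
    sup_dist K q q' \<le> C * dist \<theta> \<theta>'"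
proof -
  obtain C where "C > 0" and C: "\<And>\<delta>. \<delta> > 0 \<Longrightarrow>
      Sup {ereal (sup_dist K q q') | q q' \<theta> \<theta>'. \<theta> \<in> \<Theta> \<and> \<theta>' \<in> \<Theta> \<and> dist \<theta> \<theta>' < \<delta>
               \<and> q \<in> smooth_densities K g E \<theta> \<and> q' \<in> smooth_densities K g E \<theta>'} < ereal (C * \<delta>)"
    using assms unfolding cond_M4_def by blast
  have "sup_dist K q q' \<le> C * dist \<theta> \<theta>'"
    if "\<theta> \<in> \<Theta>" "\<theta>' \<in> \<Theta>" "q \<in> smooth_densities K g E \<theta>" "q' \<in> smooth_densities K g E \<theta>'"
    for \<theta> \<theta>' q q'
  proof (rule field_le_epsilon)
    fix e :: real assume "e > 0"
    define \<delta> where "\<delta> = dist \<theta> \<theta>' + e / C"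
    have \<delta>: "dist \<theta> \<theta>' < \<delta>" using \<open>e > 0\<close> \<open>C > 0\<close> by (simp add: \<delta>_def)
    then have "\<delta> > 0" using zero_le_dist[of \<theta> \<theta>'] by linarith
    have "ereal (sup_dist K q q') < ereal (C * \<delta>)"
      using that \<delta> by (intro le_less_trans[OF Sup_upper C[OF \<open>\<delta> > 0\<close>]]) blast
    then show "sup_dist K q q' \<le> C * dist \<theta> \<theta>' + e"
      using \<open>C > 0\<close> by (simp add: \<delta>_def distrib_left)
  qed
  then show ?thesis using \<open>C > 0\<close> by blast
qed

text \<open>For \<open>a < 1\<close> the map \<open>u \<mapsto> u powr a\<close> is not Lipschitz at \<open>0\<close>, but it is uniformly continuous
  on \<open>{0..B}\<close>, which is all that the net and the continuity of the limit require.\<close>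

lemma powr_equicontinuous:
  fixes q :: "'b::metric_space \<Rightarrow> 'a \<Rightarrow> real"
  assumes B: "\<And>\<theta> x. \<theta> \<in> \<Theta> \<Longrightarrow> x \<in> K \<Longrightarrow> q \<theta> x \<in> {0..B}"
    and lip: "\<And>\<theta> \<theta>' x. \<theta> \<in> \<Theta> \<Longrightarrow> \<theta>' \<in> \<Theta> \<Longrightarrow> x \<in> K \<Longrightarrow> \<bar>q \<theta> x - q \<theta>' x\<bar> \<le> C * dist \<theta> \<theta>'"
    and "a > 0" "\<epsilon> > 0" "C > 0"
  shows "\<exists>\<delta>>0. \<forall>\<theta>\<in>\<Theta>. \<forall>\<theta>'\<in>\<Theta>. dist \<theta> \<theta>' < \<delta> \<longrightarrow> (\<forall>x\<in>K. \<bar>q \<theta> x powr a - q \<theta>' x powr a\<bar> \<le> \<epsilon>)"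
proof -
  have "continuous_on {0..B} (\<lambda>u. u powr a)"
    using \<open>a > 0\<close> by (intro continuous_on_powr') auto
  then have "uniformly_continuous_on {0..B} (\<lambda>u. u powr a)"
    by (rule compact_uniformly_continuous) simp
  then obtain \<eta> where "\<eta> > 0" and \<eta>:
    "\<And>u v. u \<in> {0..B} \<Longrightarrow> v \<in> {0..B} \<Longrightarrow> \<bar>v - u\<bar> < \<eta> \<Longrightarrow> \<bar>v powr a - u powr a\<bar> < \<epsilon>"
    using \<open>\<epsilon> > 0\<close> unfolding uniformly_continuous_on_def dist_real_def by metis
  have "\<bar>q \<theta> x powr a - q \<theta>' x powr a\<bar> \<le> \<epsilon>"
    if "\<theta> \<in> \<Theta>" "\<theta>' \<in> \<Theta>" "dist \<theta> \<theta>' < \<eta> / C" "x \<in> K" for \<theta> \<theta>' x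
  proof -
    have "\<bar>q \<theta> x - q \<theta>' x\<bar> \<le> C * dist \<theta> \<theta>'" using lip that by blast
    also have "\<dots> < \<eta>" using that \<open>C > 0\<close> by (simp add: field_simps)
    finally have "\<bar>q \<theta> x powr a - q \<theta>' x powr a\<bar> < \<epsilon>" using that B by (intro \<eta>) auto
    then show ?thesis by simp
  qed
  then show ?thesis using \<open>\<eta> > 0\<close> \<open>C > 0\<close> by (intro exI[of _ "\<eta> / C"]) auto
qed

lemma compact_equicontinuous_net:
  fixes f :: "'b::metric_space \<Rightarrow> 'a \<Rightarrow> real"
  assumes "compact \<Theta>" and "\<delta> > 0"
    and "\<forall>\<theta>\<in>\<Theta>. \<forall>\<theta>'\<in>\<Theta>. dist \<theta> \<theta>' < \<delta> \<longrightarrow> (\<forall>x\<in>K. \<bar>f \<theta> x - f \<theta>' x\<bar> \<le> \<eta>)"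
  shows "\<exists>T\<subseteq>\<Theta>. finite T \<and> (\<forall>\<theta>\<in>\<Theta>. \<exists>t\<in>T. \<forall>x\<in>K. \<bar>f \<theta> x - f t x\<bar> \<le> \<eta>)"
proof -
  obtain T where "T \<subseteq> \<Theta>" "finite T" "\<Theta> \<subseteq> (\<Union>t\<in>T. ball t \<delta>)"
    using compactE_image[OF \<open>compact \<Theta>\<close>, of \<Theta> "\<lambda>t. ball t \<delta>"] \<open>\<delta> > 0\<close> by force
  with assms(3) show ?thesis
    by (intro exI[of _ T]) (fastforce simp: dist_commute)
qed

lemma continuous_on_alpha_criterion:
  fixes q :: "'b::metric_space \<Rightarrow> 'a::euclidean_space \<Rightarrow> real"
  assumes "compact K" "0 < \<alpha>" and P: "prob_space P" "sets P = sets (borel_on K)"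
    and q: "\<And>\<theta>. \<theta> \<in> \<Theta> \<Longrightarrow> q \<theta> \<in> nonneg_Cb K"
    and equi: "\<And>a \<epsilon>. a > 0 \<Longrightarrow> \<epsilon> > 0 \<Longrightarrow> \<exists>\<delta>>0. \<forall>\<theta>\<in>\<Theta>. \<forall>\<theta>'\<in>\<Theta>. dist \<theta> \<theta>' < \<delta> \<longrightarrow>
      (\<forall>x\<in>K. \<bar>q \<theta> x powr a - q \<theta>' x powr a\<bar> \<le> \<epsilon>)"
  shows "continuous_on \<Theta> (\<lambda>\<theta>. alpha_criterion \<alpha> K (q \<theta>) P)"
proof -
  have "continuous_on \<Theta> (\<lambda>\<theta>. \<integral>x. q \<theta> x powr a \<partial>M)"
    if M: "finite_measure M" "sets M = sets (borel_on K)" and "a > 0" for M a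
    unfolding continuous_on_iff
  proof (intro ballI allI impI)
    fix \<theta> and e :: real assume "\<theta> \<in> \<Theta>" "e > 0"
    \<comment> \<open>One is added since \<open>M\<close> may be the zero measure; it also makes the final inequality strict.\<close>
    define m where "m = measure M (space M) + 1"
    have "m > 0" by (simp add: m_def add_nonneg_pos)
    have K: "space M = K" using sets_eq_imp_space_eq[OF M(2)] by simp
    obtain \<delta> where "\<delta> > 0" and \<delta>: "\<forall>\<theta>\<in>\<Theta>. \<forall>\<theta>'\<in>\<Theta>. dist \<theta> \<theta>' < \<delta> \<longrightarrow>
      (\<forall>x\<in>K. \<bar>q \<theta> x powr a - q \<theta>' x powr a\<bar> \<le> e / m)"
      using equi[OF \<open>a > 0\<close>, of "e / m"] \<open>e > 0\<close> \<open>m > 0\<close> by auto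
    have "dist (\<integral>x. q \<theta>' x powr a \<partial>M) (\<integral>x. q \<theta> x powr a \<partial>M) < e"
      if "\<theta>' \<in> \<Theta>" "dist \<theta>' \<theta> < \<delta>" for \<theta>'
    proof -
      have "\<bar>(\<integral>x. q \<theta>' x powr a \<partial>M) - (\<integral>x. q \<theta> x powr a \<partial>M)\<bar> \<le> e / m * measure M (space M)"
        using \<delta> that \<open>\<theta> \<in> \<Theta>\<close> K \<open>a > 0\<close>
        by (intro abs_integral_diff_le nonneg_Cb_powr_integrable[OF q M] M) auto
      also have "\<dots> < e / m * m"
        using \<open>e > 0\<close> \<open>m > 0\<close> by (intro mult_strict_left_mono) (auto simp: m_def)
      finally show ?thesis using \<open>m > 0\<close> by (simp add: dist_real_def)
    qed
    then show "\<exists>d>0. \<forall>\<theta>'\<in>\<Theta>. dist \<theta>' \<theta> < d \<longrightarrow>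
        dist (\<integral>x. q \<theta>' x powr a \<partial>M) (\<integral>x. q \<theta> x powr a \<partial>M) < e"
      using \<open>\<delta> > 0\<close> by blast
  qed
  from this[OF finite_measure_lebesgue_K[OF \<open>compact K\<close>] sets_lebesgue_K, of "\<alpha> + 1"]
    this[OF prob_space.finite_measure[OF P(1)] P(2), of \<alpha>]
  show ?thesis
    unfolding alpha_criterion_def using \<open>0 < \<alpha>\<close>
    by (intro continuous_on_diff continuous_on_mult continuous_on_const) auto
qed

section \<open>Consistency\<close>

text \<open>Outside the ball of radius \<open>\<epsilon>\<close> around \<open>\<theta>0\<close> the function attains its infimum,
  which exceeds the value at \<open>\<theta>0\<close>.\<close>

lemma unique_minimum_well_separated:
  fixes R :: "'b::metric_space \<Rightarrow> real"
  assumes "compact \<Theta>" and R: "continuous_on \<Theta> R"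
    and less: "\<And>\<theta>. \<theta> \<in> \<Theta> \<Longrightarrow> \<theta> \<noteq> \<theta>0 \<Longrightarrow> R \<theta>0 < R \<theta>" and "\<epsilon> > 0"
  shows "\<exists>\<eta>>0. \<forall>\<theta>\<in>\<Theta>. R \<theta> < R \<theta>0 + \<eta> \<longrightarrow> dist \<theta> \<theta>0 \<le> \<epsilon>"
proof (cases "\<Theta> - ball \<theta>0 \<epsilon> = {}")
  case True
  then show ?thesis
    by (intro exI[of _ 1]) (fastforce simp: dist_commute)
next
  case False
  have "compact (\<Theta> - ball \<theta>0 \<epsilon>)"
    using \<open>compact \<Theta>\<close> by (rule compact_diff) simp
  then obtain t where t: "t \<in> \<Theta> - ball \<theta>0 \<epsilon>" "\<And>\<theta>. \<theta> \<in> \<Theta> - ball \<theta>0 \<epsilon> \<Longrightarrow> R t \<le> R \<theta>"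
    using continuous_attains_inf[OF _ False] continuous_on_subset[OF R] by blast
  have "R \<theta>0 < R t" using t(1) \<open>\<epsilon> > 0\<close> by (intro less) auto
  moreover have "dist \<theta> \<theta>0 \<le> \<epsilon>" if "\<theta> \<in> \<Theta>" "R \<theta> < R t" for \<theta>
    using t(2)[of \<theta>] that by (force simp: dist_commute)
  ultimately show ?thesis
    by (intro exI[of _ "R t - R \<theta>0"]) auto
qed

text \<open>Elements of \<open>E\<close> are total functions that may differ outside \<open>K\<close>, so even a model with a unique
  density can be represented by many of them; the criterion sees only their values on \<open>K\<close>.\<close>

lemma profile_criterion_eq:
  assumes "q \<in> smooth_densities K g E \<theta>"
    and "\<And>q' x. q' \<in> smooth_densities K g E \<theta> \<Longrightarrow> x \<in> K \<Longrightarrow> q' x = q x"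
    and "space P = K"
  shows "profile_criterion \<alpha> K g E P \<theta> = alpha_criterion \<alpha> K q P"
proof -
  have "(\<lambda>q'. alpha_criterion \<alpha> K q' P) ` smooth_densities K g E \<theta> = {alpha_criterion \<alpha> K q P}"
    using assms(1) alpha_criterion_cong[of K _ q P \<alpha>] assms(2,3) by blast
  then show ?thesis by (simp add: profile_criterion_def)
qed

lemma smooth_densities_nonempty:
  assumes "smooth_model K g E \<theta> \<noteq> {}"
  shows "smooth_densities K g E \<theta> \<noteq> {}"
  using assms unfolding smooth_densities_def smooth_model_def smooth_measures_def by blast

lemma alpha_criterion_uniform_law:
  fixes q :: "'b \<Rightarrow> 'a::euclidean_space \<Rightarrow> real"
  assumes iid: "prob_space S" "prob_space.indep_vars S (\<lambda>_. borel_on K) X {1..}"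
      "\<forall>i\<ge>1. distr S (borel_on K) (X i) = P0"
    and "0 < \<alpha>"
    and q: "\<And>\<theta>. \<theta> \<in> \<Theta> \<Longrightarrow> q \<theta> \<in> nonneg_Cb K"
    and B: "\<And>\<theta> x. \<theta> \<in> \<Theta> \<Longrightarrow> x \<in> K \<Longrightarrow> q \<theta> x \<in> {0..B}"
    and net: "\<And>\<eta>. \<eta> > 0 \<Longrightarrow>
      \<exists>T\<subseteq>\<Theta>. finite T \<and> (\<forall>\<theta>\<in>\<Theta>. \<exists>t\<in>T. \<forall>x\<in>K. \<bar>q \<theta> x powr \<alpha> - q t x powr \<alpha>\<bar> \<le> \<eta>)"
    and "\<epsilon> > 0"
  shows "whp S (\<lambda>n \<omega>. \<forall>\<theta>\<in>\<Theta>.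
    \<bar>alpha_criterion \<alpha> K (q \<theta>) (empirical_measure K X n \<omega>) - alpha_criterion \<alpha> K (q \<theta>) P0\<bar> \<le> \<epsilon>)"
proof -
  define c where "c = 1 + 1 / \<alpha>"
  have "c > 0" using \<open>0 < \<alpha>\<close> by (simp add: c_def add_pos_pos)
  have "(\<lambda>x. q \<theta> x powr \<alpha>) \<in> borel_measurable (borel_on K)" if "\<theta> \<in> \<Theta>" for \<theta>
    using nonneg_Cb_measurable[OF q[OF that]] by measurable
  moreover have "\<bar>q \<theta> x powr \<alpha>\<bar> \<le> B powr \<alpha>" if "\<theta> \<in> \<Theta>" "x \<in> K" for \<theta> x
    using B[OF that] \<open>0 < \<alpha>\<close> by (auto intro!: powr_mono2)
  moreover have "\<epsilon> / c > 0" using \<open>\<epsilon> > 0\<close> \<open>c > 0\<close> by simp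
  ultimately have "whp S (\<lambda>n \<omega>. \<forall>\<theta>\<in>\<Theta>.
      \<bar>(\<integral>x. q \<theta> x powr \<alpha> \<partial>empirical_measure K X n \<omega>) - (\<integral>x. q \<theta> x powr \<alpha> \<partial>P0)\<bar> \<le> \<epsilon> / c)"
    by (intro uniform_weak_law[OF iid, where B = "B powr \<alpha>"] net)
  then show ?thesis
  proof (rule whp_mono, intro ballI)
    fix n \<omega> \<theta>
    assume dev: "\<forall>\<theta>\<in>\<Theta>. \<bar>(\<integral>x. q \<theta> x powr \<alpha> \<partial>empirical_measure K X n \<omega>)
        - (\<integral>x. q \<theta> x powr \<alpha> \<partial>P0)\<bar> \<le> \<epsilon> / c" and \<theta>: "\<theta> \<in> \<Theta>"
    have "alpha_criterion \<alpha> K (q \<theta>) (empirical_measure K X n \<omega>) - alpha_criterion \<alpha> K (q \<theta>) P0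
        = - c * ((\<integral>x. q \<theta> x powr \<alpha> \<partial>empirical_measure K X n \<omega>) - (\<integral>x. q \<theta> x powr \<alpha> \<partial>P0))"
      by (simp add: alpha_criterion_def flip: c_def) (simp add: right_diff_distrib)
    then have "\<bar>alpha_criterion \<alpha> K (q \<theta>) (empirical_measure K X n \<omega>) - alpha_criterion \<alpha> K (q \<theta>) P0\<bar>
        = c * \<bar>(\<integral>x. q \<theta> x powr \<alpha> \<partial>empirical_measure K X n \<omega>) - (\<integral>x. q \<theta> x powr \<alpha> \<partial>P0)\<bar>"
      using \<open>c > 0\<close> by (simp add: abs_mult)
    also have "\<dots> \<le> c * (\<epsilon> / c)"
      using dev \<theta> \<open>c > 0\<close> by (intro mult_left_mono) auto
    finally show "\<bar>alpha_criterion \<alpha> K (q \<theta>) (empirical_measure K X n \<omega>)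
        - alpha_criterion \<alpha> K (q \<theta>) P0\<bar> \<le> \<epsilon>"
      using \<open>c > 0\<close> by simp
  qed
qed

theorem theorem5:
  fixes K :: "(real ^ 'm) set" and \<Theta> :: "(real ^ 'd) set"
    and g :: "real ^ 'm \<Rightarrow> real ^ 'd \<Rightarrow> real ^ 'l"
    and \<alpha> :: real
    and E :: "(real ^ 'm \<Rightarrow> real) set"
    and P0 :: "(real ^ 'm) measure" and p0 :: "real ^ 'm \<Rightarrow> real" and \<theta>0 :: "real ^ 'd"
    and S :: "'w measure" and X :: "nat \<Rightarrow> 'w \<Rightarrow> real ^ 'm"
    and \<theta>hat :: "nat \<Rightarrow> 'w \<Rightarrow> real ^ 'd" and qhat :: "nat \<Rightarrow> 'w \<Rightarrow> real ^ 'm \<Rightarrow> real"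
  assumes "compact K" and "compact \<Theta>" and "0 < \<alpha>" and "\<alpha> \<le> 1"
    and "CARD('l) \<le> CARD('d)"
    and "moment_function_assms K \<Theta> g"
    and "E \<subseteq> nonneg_Cb K"
    and "\<forall>\<theta>\<in>\<Theta>. smooth_model K g E \<theta> \<noteq> {}"
    and P0: "P0 \<in> prob_measures_on K"
    and p0: "p0 \<in> borel_measurable (lebesgue_K K)" "\<forall>x\<in>K. 0 \<le> p0 x"
      "P0 = density (lebesgue_K K) (\<lambda>x. ennreal (p0 x))"
    and iid: "prob_space S" "prob_space.indep_vars S (\<lambda>_. borel_on K) X {1..}"
      "\<forall>i\<ge>1. distr S (borel_on K) (X i) = P0"
    and E1: "cond_E1 K E" and E2: "cond_E2 \<alpha> K E"
    and M1: "cond_M1 K \<Theta> g" and M2: "cond_M2 K \<Theta> g E"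
    and M3: "cond_M3 \<alpha> K \<Theta> g E P0 p0" and M4: "cond_M4 K \<Theta> g E"
    and \<theta>0: "\<theta>0 \<in> \<Theta>" "P0 \<in> moment_model K g \<theta>0"
    and \<theta>hat: "\<forall>n\<ge>1. \<forall>\<omega>\<in>space S.
      is_arg_min (profile_criterion \<alpha> K g E (empirical_measure K X n \<omega>)) (\<lambda>\<theta>. \<theta> \<in> \<Theta>) (\<theta>hat n \<omega>)"
    and qhat: "\<forall>n\<ge>1. \<forall>\<omega>\<in>space S.
      is_arg_min (\<lambda>q. alpha_criterion \<alpha> K q (empirical_measure K X n \<omega>))
        (\<lambda>q. q \<in> smooth_densities K g E (\<theta>hat n \<omega>)) (qhat n \<omega>)"
  shows "tendsto_in_prob S \<theta>hat \<theta>0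
    \<and> (P0 \<in> (\<Union>\<theta>\<in>\<Theta>. smooth_model K g E \<theta>) \<longrightarrow>
        tendsto_in_prob S
          (\<lambda>n \<omega>. plugin_divergence \<alpha> K \<Theta> g E p0 (empirical_measure K X n \<omega>)) 0
        \<and> (\<forall>p\<in>E. P0 = density (lebesgue_K K) (\<lambda>x. ennreal (p x)) \<longrightarrow>
             tendsto_in_prob S (\<lambda>n \<omega>. sup_dist K (qhat n \<omega>) p) 0))"
proof -
  let ?Pn = "empirical_measure K X"
  let ?R = "\<lambda>q. alpha_criterion \<alpha> K q P0"
  note compact_K = \<open>compact K\<close> and compact_\<Theta> = \<open>compact \<Theta>\<close> and \<alpha> = \<open>0 < \<alpha>\<close>
  have P0_prob: "prob_space P0" and P0_sets: "sets P0 = sets (borel_on K)"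
    using P0 by (auto simp: prob_measures_on_def)
  have P0_space: "space P0 = K"
    using sets_eq_imp_space_eq[OF P0_sets] by simp
  have Pn_space: "space (?Pn n \<omega>) = K" for n \<omega>
    by (simp add: empirical_measure_def)
  have dens_E: "q \<in> E" if "q \<in> smooth_densities K g E \<theta>" for q \<theta>
    using that by (simp add: smooth_densities_def)
  then have dens_Cb: "q \<in> nonneg_Cb K" if "q \<in> smooth_densities K g E \<theta>" for q \<theta>
    using that \<open>E \<subseteq> nonneg_Cb K\<close> by blast
  obtain B where B: "\<And>q x. q \<in> E \<Longrightarrow> x \<in> K \<Longrightarrow> q x \<in> {0..B}"
    using cond_E1_bounded[OF E1 \<open>E \<subseteq> nonneg_Cb K\<close>] by blast
  obtain C where "C > 0" and C: "\<And>\<theta> \<theta>' q q'. \<theta> \<in> \<Theta> \<Longrightarrow> \<theta>' \<in> \<Theta> \<Longrightarrow>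
      q \<in> smooth_densities K g E \<theta> \<Longrightarrow> q' \<in> smooth_densities K g E \<theta>' \<Longrightarrow>
      sup_dist K q q' \<le> C * dist \<theta> \<theta>'"
    using cond_M4_lipschitz[OF M4] by blast
  have C': "\<bar>q x - q' x\<bar> \<le> C * dist \<theta> \<theta>'"
    if "\<theta> \<in> \<Theta>" "\<theta>' \<in> \<Theta>" "q \<in> smooth_densities K g E \<theta>" "q' \<in> smooth_densities K g E \<theta>'" "x \<in> K"
    for \<theta> \<theta>' q q' x
    by (rule order_trans[OF abs_diff_le_sup_dist[OF dens_Cb[OF that(3)] dens_Cb[OF that(4)] that(5)]
        C[OF that(1-4)]])
  have unique: "q' x = q x"
    if "\<theta> \<in> \<Theta>" "q \<in> smooth_densities K g E \<theta>" "q' \<in> smooth_densities K g E \<theta>" "x \<in> K" for \<theta> q q' x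
    using C'[of \<theta> \<theta> q' q x] that by simp
  have "\<exists>q. \<theta> \<in> \<Theta> \<longrightarrow> q \<in> smooth_densities K g E \<theta>" for \<theta>
    using smooth_densities_nonempty[of K g E \<theta>] \<open>\<forall>\<theta>\<in>\<Theta>. smooth_model K g E \<theta> \<noteq> {}\<close> by blast
  then obtain q where q: "\<And>\<theta>. \<theta> \<in> \<Theta> \<Longrightarrow> q \<theta> \<in> smooth_densities K g E \<theta>"
    by metis
  have profile: "profile_criterion \<alpha> K g E (?Pn n \<omega>) \<theta> = alpha_criterion \<alpha> K (q \<theta>) (?Pn n \<omega>)"
    if "\<theta> \<in> \<Theta>" for n \<omega> \<theta>
    by (rule profile_criterion_eq[OF q[OF that] _ Pn_space]) (rule unique[OF that q[OF that]])
  have equi: "\<exists>\<delta>>0. \<forall>\<theta>\<in>\<Theta>. \<forall>\<theta>'\<in>\<Theta>. dist \<theta> \<theta>' < \<delta> \<longrightarrow>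
      (\<forall>x\<in>K. \<bar>q \<theta> x powr a - q \<theta>' x powr a\<bar> \<le> \<epsilon>)" if "a > 0" "\<epsilon> > 0" for a \<epsilon> :: real
  proof (rule powr_equicontinuous[OF _ _ that \<open>C > 0\<close>])
    show "q \<theta> x \<in> {0..B}" if "\<theta> \<in> \<Theta>" "x \<in> K" for \<theta> x
      using B dens_E q that by blast
    show "\<bar>q \<theta> x - q \<theta>' x\<bar> \<le> C * dist \<theta> \<theta>'" if "\<theta> \<in> \<Theta>" "\<theta>' \<in> \<Theta>" "x \<in> K" for \<theta> \<theta>' x
      using C' q that by blast
  qed
  have uniform: "whp S (\<lambda>n \<omega>. \<forall>\<theta>\<in>\<Theta>. \<bar>alpha_criterion \<alpha> K (q \<theta>) (?Pn n \<omega>) - ?R (q \<theta>)\<bar> \<le> \<epsilon>)"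
    if "\<epsilon> > 0" for \<epsilon>
  proof (rule alpha_criterion_uniform_law[OF iid \<alpha> _ _ _ that])
    show "q \<theta> \<in> nonneg_Cb K" if "\<theta> \<in> \<Theta>" for \<theta>
      using dens_Cb q that by blast
    show "q \<theta> x \<in> {0..B}" if "\<theta> \<in> \<Theta>" "x \<in> K" for \<theta> x
      using B dens_E q that by blast
    fix \<eta> :: real assume "\<eta> > 0"
    then obtain \<delta> where "\<delta> > 0" and "\<forall>\<theta>\<in>\<Theta>. \<forall>\<theta>'\<in>\<Theta>. dist \<theta> \<theta>' < \<delta> \<longrightarrow>
        (\<forall>x\<in>K. \<bar>q \<theta> x powr \<alpha> - q \<theta>' x powr \<alpha>\<bar> \<le> \<eta>)"
      using equi[OF \<alpha>] by blast
    then show "\<exists>T\<subseteq>\<Theta>. finite T \<and> (\<forall>\<theta>\<in>\<Theta>. \<exists>t\<in>T. \<forall>x\<in>K. \<bar>q \<theta> x powr \<alpha> - q t x powr \<alpha>\<bar> \<le> \<eta>)"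
      by (rule compact_equicontinuous_net[OF compact_\<Theta>])
  qed
  have R_cont: "continuous_on \<Theta> (\<lambda>\<theta>. ?R (q \<theta>))"
    by (rule continuous_on_alpha_criterion[OF compact_K \<alpha> P0_prob P0_sets _ equi])
       (use dens_Cb q in blast)
  \<comment> \<open>The infimum over the model at \<open>\<theta>0\<close> is only known to lie below that at \<open>\<theta>\<close>; a density \<open>q'\<close>
      witnessing this agrees with \<open>q \<theta>0\<close> on \<open>K\<close>.\<close>
  have R_less: "?R (q \<theta>0) < ?R (q \<theta>)" if "\<theta> \<in> \<Theta>" "\<theta> \<noteq> \<theta>0" for \<theta>
  proof -
    have "(INF q\<in>smooth_densities K g E \<theta>0. alpha_divergence \<alpha> K q p0)
        < (INF q\<in>smooth_densities K g E \<theta>. alpha_divergence \<alpha> K q p0)"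
      using M3 \<theta>0 that unfolding cond_M3_def by blast
    also have "\<dots> \<le> alpha_divergence \<alpha> K (q \<theta>) p0"
      by (rule INF_lower) (rule q[OF that(1)])
    finally obtain q' where q': "q' \<in> smooth_densities K g E \<theta>0"
      and less: "alpha_divergence \<alpha> K q' p0 < alpha_divergence \<alpha> K (q \<theta>) p0"
      by (auto simp: INF_less_iff)
    have "?R q' < ?R (q \<theta>)"
      using alpha_criterion_less_of_divergence_less[OF compact_K \<alpha> _ _ p0(1,2) _ P0_prob less] p0(3)
        dens_Cb[OF q'] dens_Cb[OF q[OF that(1)]] by blast
    moreover have "?R q' = ?R (q \<theta>0)"
      using unique[OF \<theta>0(1) q[OF \<theta>0(1)] q'] P0_space by (intro alpha_criterion_cong)
    ultimately show ?thesis by simp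
  qed
  have \<theta>hat_mem: "\<theta>hat n \<omega> \<in> \<Theta>" if "n \<ge> 1" "\<omega> \<in> space S" for n \<omega>
    using \<theta>hat that by (simp add: is_arg_min_def)
  have \<theta>hat_le: "profile_criterion \<alpha> K g E (?Pn n \<omega>) (\<theta>hat n \<omega>) \<le> profile_criterion \<alpha> K g E (?Pn n \<omega>) \<theta>"
    if "n \<ge> 1" "\<omega> \<in> space S" "\<theta> \<in> \<Theta>" for n \<omega> \<theta>
    using \<theta>hat that by (force simp: is_arg_min_def not_less)
  \<comment> \<open>If the empirical criterion is within \<open>\<eta> / 3\<close> of its limit, its argmin is an approximate
      minimizer of the limit up to \<open>2 * \<eta> / 3\<close>.\<close>
  have \<theta>hat_tendsto: "whp S (\<lambda>n \<omega>. dist (\<theta>hat n \<omega>) \<theta>0 \<le> \<epsilon>)" if \<epsilon>: "\<epsilon> > 0" for \<epsilon>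
  proof -
    have "\<exists>\<eta>>0. \<forall>\<theta>\<in>\<Theta>. ?R (q \<theta>) < ?R (q \<theta>0) + \<eta> \<longrightarrow> dist \<theta> \<theta>0 \<le> \<epsilon>"
      by (rule unique_minimum_well_separated[OF compact_\<Theta> R_cont _ \<epsilon>]) (rule R_less)
    then obtain \<eta> where "\<eta> > 0"
      and \<eta>: "\<And>\<theta>. \<theta> \<in> \<Theta> \<Longrightarrow> ?R (q \<theta>) < ?R (q \<theta>0) + \<eta> \<Longrightarrow> dist \<theta> \<theta>0 \<le> \<epsilon>"
      by auto
    from uniform[of "\<eta> / 3"] \<open>\<eta> > 0\<close>
    have "whp S (\<lambda>n \<omega>. \<forall>\<theta>\<in>\<Theta>. \<bar>alpha_criterion \<alpha> K (q \<theta>) (?Pn n \<omega>) - ?R (q \<theta>)\<bar> \<le> \<eta> / 3)"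
      by simp
    then show ?thesis
    proof (rule whp_mono)
      fix n \<omega> assume n\<omega>: "n \<ge> 1" "\<omega> \<in> space S"
        and dev: "\<forall>\<theta>\<in>\<Theta>. \<bar>alpha_criterion \<alpha> K (q \<theta>) (?Pn n \<omega>) - ?R (q \<theta>)\<bar> \<le> \<eta> / 3"
      show "dist (\<theta>hat n \<omega>) \<theta>0 \<le> \<epsilon>"
        using dev[rule_format, OF \<theta>hat_mem[OF n\<omega>]] dev[rule_format, OF \<theta>0(1)] \<open>\<eta> > 0\<close>
          \<theta>hat_le[OF n\<omega> \<theta>0(1), unfolded profile[OF \<theta>hat_mem[OF n\<omega>]] profile[OF \<theta>0(1)]]
        by (intro \<eta> \<theta>hat_mem n\<omega>) linarith
    qed
  qed
  have truth_dens: "p \<in> smooth_densities K g E \<theta>0"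
    if "p \<in> E" "P0 = density (lebesgue_K K) (\<lambda>x. ennreal (p x))" for p
    using that \<theta>0(2) prob_space.finite_measure[OF P0_prob]
    by (auto simp: smooth_densities_def smooth_model_def smooth_measures_def)
  have qhat_tendsto: "tendsto_in_prob S (\<lambda>n \<omega>. sup_dist K (qhat n \<omega>) p) 0"
    if p: "p \<in> E" "P0 = density (lebesgue_K K) (\<lambda>x. ennreal (p x))" for p
    unfolding tendsto_in_prob_iff_whp
  proof (intro allI impI)
    fix \<epsilon> :: real assume "\<epsilon> > 0"
    with \<open>C > 0\<close> have "whp S (\<lambda>n \<omega>. dist (\<theta>hat n \<omega>) \<theta>0 \<le> \<epsilon> / C)"
      by (intro \<theta>hat_tendsto) simp
    then show "whp S (\<lambda>n \<omega>. dist (sup_dist K (qhat n \<omega>) p) 0 \<le> \<epsilon>)"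
    proof (rule whp_mono)
      fix n \<omega> assume n\<omega>: "n \<ge> 1" "\<omega> \<in> space S" and close: "dist (\<theta>hat n \<omega>) \<theta>0 \<le> \<epsilon> / C"
      have qhat_dens: "qhat n \<omega> \<in> smooth_densities K g E (\<theta>hat n \<omega>)"
        using qhat n\<omega> by (simp add: is_arg_min_def)
      have "sup_dist K (qhat n \<omega>) p \<le> C * dist (\<theta>hat n \<omega>) \<theta>0"
        by (rule C[OF \<theta>hat_mem[OF n\<omega>] \<theta>0(1) qhat_dens truth_dens[OF p]])
      also have "\<dots> \<le> \<epsilon>" using close \<open>C > 0\<close> by (simp add: field_simps)
      finally have "sup_dist K (qhat n \<omega>) p \<le> \<epsilon>" .
      moreover have "0 \<le> sup_dist K (qhat n \<omega>) p"
      proof -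
        obtain x where "x \<in> K" using prob_space.not_empty[OF P0_prob] P0_space by blast
        then show ?thesis
          by (intro order_trans[OF abs_ge_zero
                abs_diff_le_sup_dist[OF dens_Cb[OF qhat_dens] dens_Cb[OF truth_dens[OF p]]]])
      qed
      ultimately show "dist (sup_dist K (qhat n \<omega>) p) 0 \<le> \<epsilon>" by simp
    qed
  qed
  have divergence_tendsto:
    "tendsto_in_prob S (\<lambda>n \<omega>. plugin_divergence \<alpha> K \<Theta> g E p0 (?Pn n \<omega>)) 0"
    if P0_smooth: "P0 \<in> (\<Union>\<theta>\<in>\<Theta>. smooth_model K g E \<theta>)"
    unfolding tendsto_in_prob_iff_whp
  proof (intro allI impI)
    fix \<epsilon> :: real assume "\<epsilon> > 0"
    obtain p where p: "p \<in> E" "P0 = density (lebesgue_K K) (\<lambda>x. ennreal (p x))"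
      using P0_smooth by (auto simp: smooth_model_def smooth_measures_def)
    have "?R (q \<theta>0) = ?R p"
      using unique[OF \<theta>0(1) truth_dens[OF p] q[OF \<theta>0(1)]] P0_space by (intro alpha_criterion_cong)
    then have zero: "?R (q \<theta>0) + 1 / \<alpha> * (\<integral>x. p0 x powr (\<alpha> + 1) \<partial>lebesgue_K K) = 0"
      using alpha_criterion_at_truth[OF compact_K \<alpha> dens_Cb[OF truth_dens[OF p]] p0 p(2)] by simp
    from uniform[OF \<open>\<epsilon> > 0\<close>]
    show "whp S (\<lambda>n \<omega>. dist (plugin_divergence \<alpha> K \<Theta> g E p0 (?Pn n \<omega>)) 0 \<le> \<epsilon>)"
    proof (rule whp_mono)
      fix n \<omega> assume n\<omega>: "n \<ge> 1" "\<omega> \<in> space S"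
        and dev: "\<forall>\<theta>\<in>\<Theta>. \<bar>alpha_criterion \<alpha> K (q \<theta>) (?Pn n \<omega>) - ?R (q \<theta>)\<bar> \<le> \<epsilon>"
      let ?t = "\<theta>hat n \<omega>"
      have "(INF \<theta>\<in>\<Theta>. profile_criterion \<alpha> K g E (?Pn n \<omega>) \<theta>) = alpha_criterion \<alpha> K (q ?t) (?Pn n \<omega>)"
        unfolding profile[OF \<theta>hat_mem[OF n\<omega>], symmetric]
        using \<theta>hat_mem[OF n\<omega>] \<theta>hat_le[OF n\<omega>] by (intro cInf_eq_minimum) auto
      moreover have "alpha_criterion \<alpha> K (q ?t) (?Pn n \<omega>) \<le> ?R (q \<theta>0) + \<epsilon>"
        using \<theta>hat_le[OF n\<omega> \<theta>0(1)] dev[rule_format, OF \<theta>0(1)]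
        by (simp add: profile \<theta>hat_mem[OF n\<omega>] \<theta>0)
      moreover have "?R (q \<theta>0) - \<epsilon> \<le> alpha_criterion \<alpha> K (q ?t) (?Pn n \<omega>)"
        using dev[rule_format, OF \<theta>hat_mem[OF n\<omega>]] R_less[OF \<theta>hat_mem[OF n\<omega>]]
        by (cases "?t = \<theta>0") auto
      ultimately show "dist (plugin_divergence \<alpha> K \<Theta> g E p0 (?Pn n \<omega>)) 0 \<le> \<epsilon>"
        using zero unfolding plugin_divergence_def dist_real_def by linarith
    qed
  qed
  have "tendsto_in_prob S \<theta>hat \<theta>0"
    unfolding tendsto_in_prob_iff_whp using \<theta>hat_tendsto by simp
  then show ?thesis
    using qhat_tendsto divergence_tendsto by blast
qed

end
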